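(* Let $n\geq 2$ be an integer and let $u\in C^{\infty}(\mathbb{S}^{n})$. Let $\Phi_{n}\in\mathbb{S}^{n}$ be an arbitrary point and let $d=d(\cdot,\Phi_n):\mathbb{S}^n\to[0,\pi]$ be the geodesic distance from $\Phi_n$ on $\mathbb{S}^n$. Then $$\int_{\mathbb{S}^{n}}\left|\nabla_{\mathbb{S}^{n}} u\right|^{n}d\sigma_{n}+(n-1)\left(\frac{n-1}{n}\right)^{n-1}\int_{\mathbb{S}^{n}}\frac{|u|^{n}}{|\tan d|^{n-2}\left(\log\frac{e}{\sin d}\right)^{n-1}}\,d\sigma_{n}\;\geq\;\left(\frac{n-1}{n}\right)^{n}\int_{\mathbb{S}^{n}}\frac{|u|^{n}}{|\tan d|^{n}\left(\log\frac{e}{\sin d}\right)^{n}}\,d\sigma_{n}.$$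
   Context: $\mathbb{S}^{n}$ is the unit sphere in $\mathbb{R}^{n+1}$ and $\sigma_n$ is its surface measure. $C^\infty(\mathbb{S}^n)$ denotes the smooth real-valued functions on $\mathbb{S}^n$, and $\nabla_{\mathbb{S}^n}$ is the surface (Riemannian) gradient for the standard round metric. For $x,\Phi_n\in\mathbb{S}^n$ the geodesic distance is $d(x,\Phi_n)=\arccos\left(\sum_{m=1}^{n+1}x_m(\Phi_n)_m\right)\in[0,\pi]$, where $x_m$ and $(\Phi_n)_m$ are the Cartesian coordinates of $x$ and $\Phi_n$ in $\mathbb{R}^{n+1}$. Here $\log$ is the natural logarithm and $e$ its base. For $0<d<\pi$, $1/|\tan d|$ is understood as $|\cos d|/\sin d$, and $1/|\tan d|^{0}=1$ when $n=2$. The points $\pm\Phi_n$, where $\sin d=0$, form a set of measure zero. *)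

theory Defs
  imports "HOL-Analysis.Analysis"
begin

section \<open>Smooth functions\<close>

primrec Ck_on :: "nat \<Rightarrow> 'a::euclidean_space set \<Rightarrow> ('a \<Rightarrow> real) \<Rightarrow> bool" where
  "Ck_on 0 U f \<longleftrightarrow> continuous_on U f"
| "Ck_on (Suc k) U f \<longleftrightarrow> (\<forall>x\<in>U. f differentiable (at x)) \<and>
     (\<forall>v. Ck_on k U (\<lambda>x. frechet_derivative f (at x) v))"

text \<open>Only meaningful for open \<open>U\<close>, since the derivatives are taken at points of the ambient
  space.\<close>

definition Cinf_on_open :: "'a::euclidean_space set \<Rightarrow> ('a \<Rightarrow> real) \<Rightarrow> bool" where
  "Cinf_on_open U f \<longleftrightarrow> open U \<and> (\<forall>k. Ck_on k U f)"

text \<open>Smoothness on an arbitrary subset: every point has an open neighbourhood in the ambient space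
  to which the function extends smoothly. On an embedded submanifold this is the usual notion of a
  smooth function. The values of \<open>u\<close> outside \<open>S\<close> play no role.\<close>

definition smooth_on :: "'a::euclidean_space set \<Rightarrow> ('a \<Rightarrow> real) \<Rightarrow> bool" where
  "smooth_on S u \<longleftrightarrow>
     (\<forall>x\<in>S. \<exists>U F. x \<in> U \<and> Cinf_on_open U F \<and> (\<forall>y\<in>U \<inter> S. F y = u y))"

section \<open>The gradient on the unit sphere\<close>

text \<open>The unit sphere carries the metric induced from the ambient Euclidean space, so the Riemannian
  gradient of \<open>u\<close> at \<open>x\<close> is the vector \<open>v\<close> of the tangent space \<open>{v. v \<bullet> x = 0}\<close> such that
  \<open>h \<mapsto> v \<bullet> h\<close> is the differential of \<open>u\<close> along the sphere. Lemma \<open>sphere_gradient_unique\<close> shows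
  that there is at most one such \<open>v\<close>, and \<open>sphere_gradient_eq\<close> that \<open>v\<close> is the tangential part of
  the Euclidean gradient of any differentiable extension.\<close>

definition is_sphere_gradient :: "('a::euclidean_space \<Rightarrow> real) \<Rightarrow> 'a \<Rightarrow> 'a \<Rightarrow> bool" where
  "is_sphere_gradient u x v \<longleftrightarrow>
     v \<bullet> x = 0 \<and> (u has_derivative (\<lambda>h. v \<bullet> h)) (at x within sphere 0 1)"

definition sphere_gradient :: "('a::euclidean_space \<Rightarrow> real) \<Rightarrow> 'a \<Rightarrow> 'a" where
  "sphere_gradient u x = (THE v. is_sphere_gradient u x v)"

lemma sphere_gradient_unique:
  fixes x :: "'a::euclidean_space"
  assumes x: "x \<in> sphere 0 1"
    and v: "is_sphere_gradient u x v" and w: "is_sphere_gradient u x w"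
  shows "v = w"
proof (rule ccontr)
  assume "v \<noteq> w"
  define h where "h = (v - w) /\<^sub>R norm (v - w)"
  define c where "c = (\<lambda>t::real. cos t *\<^sub>R x + sin t *\<^sub>R h)"
  have xx: "x \<bullet> x = 1" using x by (simp add: norm_eq_1)
  have hh: "h \<bullet> h = 1" using \<open>v \<noteq> w\<close>
    by (simp add: h_def norm_eq_1[symmetric] del: inner_scaleR_left inner_scaleR_right)
  have hx: "h \<bullet> x = 0"
    using v w by (simp add: h_def is_sphere_gradient_def inner_diff_left)
  have c_sphere: "c t \<in> sphere 0 1" for t
  proof -
    have "c t \<bullet> c t = (cos t)\<^sup>2 + (sin t)\<^sup>2"
      using xx hh hx
      by (simp add: c_def inner_add_left inner_add_right inner_commute[of x h] power2_eq_square)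
    then show ?thesis by (simp add: norm_eq_1)
  qed
  have c0: "c 0 = x" by (simp add: c_def)
  have c_der: "(c has_derivative (\<lambda>t. t *\<^sub>R h)) (at 0)"
    unfolding c_def by (auto intro!: derivative_eq_intros)
  have comp: "(u \<circ> c has_derivative (\<lambda>t. z \<bullet> (t *\<^sub>R h))) (at 0)"
    if "is_sphere_gradient u x z" for z
  proof -
    have "(u has_derivative (\<lambda>h. z \<bullet> h)) (at (c 0) within range c)"
      using that c0 c_sphere unfolding is_sphere_gradient_def
      by (auto intro: has_derivative_subset)
    from diff_chain_within[OF c_der this] show ?thesis by (simp add: o_def)
  qed
  have "(\<lambda>t::real. v \<bullet> (t *\<^sub>R h)) = (\<lambda>t. w \<bullet> (t *\<^sub>R h))"
    using has_derivative_unique[OF comp[OF v] comp[OF w]] .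
  from fun_cong[OF this, of 1] have "(v - w) \<bullet> h = 0" by (simp add: inner_diff_left)
  then have "(v - w) \<bullet> (v - w) = 0" using \<open>v \<noteq> w\<close> by (simp add: h_def)
  then show False using \<open>v \<noteq> w\<close> by simp
qed

lemma sphere_gradient_eq:
  fixes x g :: "'a::euclidean_space"
  assumes x: "x \<in> sphere 0 1" and U: "open U" "x \<in> U"
    and F: "(F has_derivative (\<lambda>h. g \<bullet> h)) (at x)"
    and eq: "\<And>y. y \<in> U \<inter> sphere 0 1 \<Longrightarrow> F y = u y"
  shows "is_sphere_gradient u x (g - (g \<bullet> x) *\<^sub>R x)"
    and "sphere_gradient u x = g - (g \<bullet> x) *\<^sub>R x"
proof -
  let ?v = "g - (g \<bullet> x) *\<^sub>R x"
  have xx: "x \<bullet> x = 1" using x by (simp add: norm_eq_1)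
  define G where
    "G = (\<lambda>y. F y - (g \<bullet> x) * (x \<bullet> y) + (g \<bullet> x) * (1 - (y - x) \<bullet> (y - x) / 2))"
  have "(G has_derivative (\<lambda>h. ?v \<bullet> h)) (at x within sphere 0 1 \<inter> U)"
    unfolding G_def
    by (rule derivative_eq_intros has_derivative_at_withinI[OF F] refl)+
       (auto simp: fun_eq_iff inner_diff_left)
  moreover have "G y = u y" if "y \<in> sphere 0 1 \<inter> U" for y
  proof -
    have "y \<bullet> y = 1" using that by (simp add: norm_eq_1)
    then have "(y - x) \<bullet> (y - x) = 2 - 2 * (x \<bullet> y)"
      using xx by (simp add: inner_diff_left inner_diff_right inner_commute)
    then have "1 - (y - x) \<bullet> (y - x) / 2 = x \<bullet> y" by (simp add: field_simps)
    then show ?thesis using that eq unfolding G_def by simp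
  qed
  ultimately have "(u has_derivative (\<lambda>h. ?v \<bullet> h)) (at x within sphere 0 1 \<inter> U)"
    using x U by (metis (no_types, lifting) IntI has_derivative_transform)
  then have "(u has_derivative (\<lambda>h. ?v \<bullet> h)) (at x within sphere 0 1)"
    using at_within_nhd[OF U(2,1), of "sphere 0 1 \<inter> U" "sphere 0 1"] by auto
  then show *: "is_sphere_gradient u x ?v"
    using xx by (simp add: is_sphere_gradient_def inner_diff_left)
  show "sphere_gradient u x = ?v"
    unfolding sphere_gradient_def
    using * sphere_gradient_unique[OF x] by (blast intro: the_equality)
qed

section \<open>Surface measure on the unit sphere\<close>

text \<open>Surface measure as the cone measure: \<open>\<sigma>(A)\<close> is the dimension of the ambient space times the
  Lebesgue measure of the cone \<open>{t x | x \<in> A, 0 < t < 1}\<close>, see \<open>emeasure_sphere_measure\<close>. This is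
  the unnormalised measure \<open>\<sigma>\<close> of the polar coordinate formula
  \<open>\<integral> f dx = \<integral>\<^sub>0\<^sup>\<infinity> (\<integral> f(r \<omega>) d\<sigma>(\<omega>)) r\<^sup>n dr\<close> on an ambient space of dimension \<open>n + 1\<close>.\<close>

definition sphere_measure :: "'a::euclidean_space measure" where
  "sphere_measure =
     scale_measure (of_nat DIM('a))
       (distr (restrict_space lborel (ball 0 1 - {0})) (restrict_space borel (sphere 0 1))
          (\<lambda>x. x /\<^sub>R norm x))"

lemma measurable_radial_projection:
  "(\<lambda>x::'a::euclidean_space. x /\<^sub>R norm x)
     \<in> restrict_space lborel (ball 0 1 - {0}) \<rightarrow>\<^sub>M restrict_space borel (sphere 0 1)"
  by (rule measurable_restrict_space3) auto

lemma space_sphere_measure [simp]: "space sphere_measure = sphere 0 1"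
  by (simp add: sphere_measure_def space_scale_measure space_restrict_space)

lemma sets_sphere_measure [simp]: "sets sphere_measure = sets (restrict_space borel (sphere 0 1))"
  by (simp add: sphere_measure_def)

lemma emeasure_sphere_measure:
  fixes A :: "'a::euclidean_space set"
  assumes A: "A \<in> sets borel" "A \<subseteq> sphere 0 1"
  shows "emeasure sphere_measure A =
    of_nat DIM('a) * emeasure lborel {t *\<^sub>R x | t x. 0 < t \<and> t < 1 \<and> x \<in> A}"
proof -
  let ?p = "\<lambda>x::'a. x /\<^sub>R norm x"
  have A': "A \<in> sets (restrict_space borel (sphere 0 1))"
    using A by (auto simp: sets_restrict_space)
  have cone: "?p -` A \<inter> (ball 0 1 - {0}) = {t *\<^sub>R x | t x. 0 < t \<and> t < 1 \<and> x \<in> A}"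
    (is "?L = ?R")
  proof
    show "?L \<subseteq> ?R"
    proof
      fix y assume "y \<in> ?L"
      then have "y = norm y *\<^sub>R ?p y" "0 < norm y" "norm y < 1" "?p y \<in> A" by auto
      then show "y \<in> ?R" by blast
    qed
    show "?R \<subseteq> ?L" using A(2) by (auto simp: subset_eq)
  qed
  show ?thesis
    by (simp only: sphere_measure_def emeasure_scale_measure
        emeasure_distr[OF measurable_radial_projection A'] space_restrict_space)
       (subst emeasure_restrict_space, auto simp: cone[symmetric])
qed

end

theory Submission
  imports Defs
begin

text \<open>
  The cone measure of the sphere can be computed on the cylinder \<open>0 < |y| \<le> 1\<close> around the axis through
  \<open>\<Phi>\<close> instead of on the ball, where \<open>y\<close> is the component orthogonal to \<open>\<Phi>\<close>. A line parallel to \<open>\<Phi>\<close>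
  projects radially onto a meridian, and the weight is such that Fubini along these lines reduces the
  theorem to an inequality on each meridian separately, with no singularity inside the line.

  On a line, write \<open>X\<close>, \<open>Y\<close> for the weighted integrands of the right and left side and \<open>a = (n-1)/n\<close>.
  The function \<open>P = |u|\<^sup>n g\<close>, where \<open>g\<close> corresponds to the field \<open>|cot d|\<^sup>n\<^sup>-\<^sup>2 cot d / (log (e / sin d))\<^sup>n\<^sup>-\<^sup>1\<close>,
  has derivative \<open>(n-1) (Y - X)\<close> plus a term which Young's inequality bounds by
  \<open>|\<nabla>u|\<^sup>n + (n-1) a\<^sup>n X\<close> after multiplication by \<open>a\<^sup>n\<^sup>-\<^sup>1\<close>. As \<open>(n-1) a\<^sup>n\<^sup>-\<^sup>1 = n a\<^sup>n\<close>, this reads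
  \<open>a\<^sup>n X + a\<^sup>n\<^sup>-\<^sup>1 P' \<le> |\<nabla>u|\<^sup>n + (n-1) a\<^sup>n\<^sup>-\<^sup>1 Y\<close>, and \<open>P\<close> vanishes at both ends because
  the logarithm tends to infinity there.
\<close>

section \<open>The one-dimensional inequality\<close>

lemma Youngs_inequality_power:
  fixes A B :: real
  assumes "0 \<le> A" "0 \<le> B"
  shows "(real m + 1) * A * B ^ m \<le> A ^ (m + 1) + real m * B ^ (m + 1)"
proof (induction m)
  case 0
  then show ?case by simp
next
  case (Suc m)
  \<comment> \<open>Both factors have the same sign by monotonicity of powers. Adding this product
    to \<open>B\<close> times the induction hypothesis gives the next case.\<close>
  have "0 \<le> (A ^ (m + 1) - B ^ (m + 1)) * (A - B)"
  proof (cases "A \<le> B")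
    case True
    with power_mono[OF True assms(1), of "m + 1"] show ?thesis by (intro mult_nonpos_nonpos) auto
  next
    case False
    with power_mono[OF _ assms(2), of A "m + 1"] show ?thesis by (intro mult_nonneg_nonneg) auto
  qed
  with mult_right_mono[OF Suc.IH assms(2)] show ?case
    by (simp add: algebra_simps)
qed

text \<open>Signed powers have no kink at 0, so \<open>|f|^n\<close> can be differentiated where
  \<open>f\<close> changes sign.\<close>

lemma DERIV_abs_power_mult:
  fixes x :: real
  shows "((\<lambda>x. \<bar>x\<bar> ^ m * x) has_real_derivative (real m + 1) * \<bar>x\<bar> ^ m) (at x)"
proof -
  consider "x > 0" | "x < 0" | "x = 0" by linarith
  then show ?thesis
  proof cases
    case 1
    have "((\<lambda>x. x ^ Suc m) has_real_derivative (real m + 1) * x ^ m) (at x)"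
      using DERIV_pow[of "Suc m" x] by (simp add: add.commute)
    then have "((\<lambda>x. \<bar>x\<bar> ^ m * x) has_real_derivative (real m + 1) * x ^ m) (at x)"
      by (rule has_field_derivative_transform_within[of _ _ _ _ x]) (use 1 in \<open>auto simp: dist_real_def\<close>)
    with 1 show ?thesis by simp
  next
    case 2
    have "((\<lambda>x. - ((- x) ^ Suc m)) has_real_derivative (real m + 1) * (- x) ^ m) (at x)"
      by (rule derivative_eq_intros refl | simp)+
    then have "((\<lambda>x. \<bar>x\<bar> ^ m * x) has_real_derivative (real m + 1) * (- x) ^ m) (at x)"
      by (rule has_field_derivative_transform_within[of _ _ _ _ "- x"]) (use 2 in \<open>auto simp: dist_real_def\<close>)
    with 2 show ?thesis by simp
  next
    case 3
    \<comment> \<open>At 0 the difference quotient is \<open>|h|^m\<close>; for \<open>m = 0\<close>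
      the limit is 1, in agreement with \<open>0 ^ 0 = 1\<close>.\<close>
    have "((\<lambda>h::real. \<bar>h\<bar> ^ m) \<longlongrightarrow> \<bar>0\<bar> ^ m) (at 0)"
      by (intro tendsto_intros)
    then have "((\<lambda>h::real. \<bar>h\<bar> ^ m * h / h) \<longlongrightarrow> \<bar>0\<bar> ^ m) (at 0)"
      by (rule Lim_transform_eventually) (auto simp: eventually_at_filter)
    then show ?thesis unfolding DERIV_def 3 by (cases m) auto
  qed
qed

lemma DERIV_abs_power:
  fixes x :: real
  shows "((\<lambda>x. \<bar>x\<bar> ^ (m + 2)) has_real_derivative (real m + 2) * (\<bar>x\<bar> ^ m * x)) (at x)"
proof -
  have "(\<lambda>x::real. \<bar>x\<bar> ^ (m + 2)) = (\<lambda>x. \<bar>x\<bar> ^ m * x * x)"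
    by (simp add: fun_eq_iff power_add mult.assoc flip: power2_eq_square)
  moreover have "((\<lambda>x::real. \<bar>x\<bar> ^ m * x * x) has_real_derivative (real m + 2) * (\<bar>x\<bar> ^ m * x)) (at x)"
    by (rule derivative_eq_intros DERIV_abs_power_mult refl)+ (simp add: algebra_simps)
  ultimately show ?thesis by simp
qed

text \<open>Over \<open>[-k, k]\<close> the derivative contributes only
  \<open>P k - P (- k)\<close>, which tends to 0. The detour over bounded intervals is taken because
  neither \<open>A\<close> nor \<open>P'\<close> is known to be integrable on the whole
  line.\<close>

lemma nn_integral_le_of_null_boundary:
  fixes A B P P' :: "real \<Rightarrow> real"
  assumes A: "continuous_on UNIV A" "\<And>s. 0 \<le> A s"
    and B: "continuous_on UNIV B" "\<And>s. 0 \<le> B s"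
    and P: "\<And>s. (P has_real_derivative P' s) (at s)" "continuous_on UNIV P'"
    and le: "\<And>s. A s + P' s \<le> B s"
    and lim: "(P \<longlongrightarrow> 0) at_top" "(P \<longlongrightarrow> 0) at_bot"
  shows "(\<integral>\<^sup>+s. ennreal (A s) \<partial>lborel) \<le> (\<integral>\<^sup>+s. ennreal (B s) \<partial>lborel)"
proof (cases "(\<integral>\<^sup>+s. ennreal (B s) \<partial>lborel) = \<infinity>")
  case False
  have [measurable]: "A \<in> borel_measurable borel" "B \<in> borel_measurable borel"
    using A B borel_measurable_continuous_onI by auto
  have intB: "integrable lborel B"
    using False B(2) by (intro integrableI_nonneg) (auto simp: less_top)
  let ?I = "\<lambda>k::nat. {- real k .. real k}"
  have intI: "set_integrable lborel (?I k) f" if "continuous_on UNIV f" for k and f :: "real \<Rightarrow> real"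
    unfolding set_integrable_def
    using that by (intro borel_integrable_compact) (auto intro: continuous_on_subset)
  have bound: "(LINT s:?I k|lborel. A s) \<le> integral\<^sup>L lborel B - (P (real k) - P (- real k))" for k
  proof -
    have "(LINT s:?I k|lborel. P' s) = P (real k) - P (- real k)"
      unfolding set_lebesgue_integral_def
      using P by (intro integral_FTC_Icc)
        (auto simp: has_real_derivative_iff_has_vector_derivative[symmetric]
          intro: has_field_derivative_at_within continuous_on_subset)
    moreover have "(LINT s:?I k|lborel. A s) + (LINT s:?I k|lborel. P' s) \<le> (LINT s:?I k|lborel. B s)"
      unfolding set_integral_add(2)[OF intI[OF A(1)] intI[OF P(2)], symmetric]
      by (intro set_integral_mono set_integral_add intI A P B le)
    moreover have "(LINT s:?I k|lborel. B s) \<le> integral\<^sup>L lborel B"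
      unfolding set_lebesgue_integral_def
      using B(2) intB intI[OF B(1)]
      by (intro integral_mono) (auto simp: set_integrable_def split: split_indicator)
    ultimately show ?thesis by linarith
  qed
  \<comment> \<open>Monotone convergence recovers the full integral of \<open>A\<close> without
    presupposing that it is finite.\<close>
  have "(\<lambda>k. \<integral>\<^sup>+s. ennreal (A s) * indicator (?I k) s \<partial>lborel) \<longlonglongrightarrow> (\<integral>\<^sup>+s. ennreal (A s) \<partial>lborel)"
  proof (rule nn_integral_LIMSEQ)
    show "incseq (\<lambda>k s. ennreal (A s) * indicator (?I k) s)"
      by (auto simp: incseq_def le_fun_def split: split_indicator)
    show "(\<lambda>k. ennreal (A s) * indicator (?I k) s) \<longlonglongrightarrow> ennreal (A s)" for s
    proof -
      obtain k0 where "\<bar>s\<bar> \<le> real k0" using real_arch_simple by blast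
      then have "eventually (\<lambda>k. ennreal (A s) * indicator (?I k) s = ennreal (A s)) sequentially"
        by (auto simp: eventually_sequentially intro!: exI[of _ k0] split: split_indicator)
      then show ?thesis by (rule tendsto_eventually)
    qed
  qed auto
  moreover have "(\<integral>\<^sup>+s. ennreal (A s) * indicator (?I k) s \<partial>lborel)
      \<le> ennreal (integral\<^sup>L lborel B - (P (real k) - P (- real k)))" for k
  proof -
    have "(\<integral>\<^sup>+s. ennreal (A s) * indicator (?I k) s \<partial>lborel) = (\<integral>\<^sup>+s. ennreal (indicator (?I k) s *\<^sub>R A s) \<partial>lborel)"
      by (intro nn_integral_cong) (auto split: split_indicator)
    also have "\<dots> = ennreal (LINT s:?I k|lborel. A s)"
      unfolding set_lebesgue_integral_def
      using intI[OF A(1)] A(2) by (intro nn_integral_eq_integral) (auto simp: set_integrable_def)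
    finally show ?thesis using bound by (simp add: ennreal_leI)
  qed
  moreover have "(\<lambda>k. ennreal (integral\<^sup>L lborel B - (P (real k) - P (- real k))))
      \<longlonglongrightarrow> ennreal (integral\<^sup>L lborel B - (0 - 0))"
    by (intro tendsto_ennrealI tendsto_intros filterlim_compose[OF lim(1)]
        filterlim_compose[OF lim(2)] filterlim_real_sequentially
        filterlim_compose[OF filterlim_uminus_at_bot_at_top])
  ultimately have "(\<integral>\<^sup>+s. ennreal (A s) \<partial>lborel) \<le> ennreal (integral\<^sup>L lborel B - (0 - 0))"
    by (intro LIMSEQ_le) auto
  then show ?thesis
    using nn_integral_eq_integral[OF intB] B(2) by simp
qed simp

section \<open>The logarithmic Hardy inequality on one line parallel to the axis\<close>

context
  fixes \<rho> :: real
  assumes rho: "\<rho> > 0"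
begin

text \<open>At the point \<open>y + s \<Phi>\<close> of the line through \<open>y \<bottom> \<Phi>\<close>, \<open>|y| = \<rho>\<close>, one has \<open>sin d = \<rho> / line_norm s\<close>,
  \<open>1 / tan d = s / \<rho>\<close> and \<open>log (e / sin d) = line_log s\<close>.\<close>

definition "line_norm s = sqrt (s\<^sup>2 + \<rho>\<^sup>2)"
definition "line_log s = 1 + ln (line_norm s / \<rho>)"

lemma line_norm_pos: "line_norm s > 0"
  using rho unfolding line_norm_def by (intro real_sqrt_gt_zero add_nonneg_pos) auto

lemma line_norm_sq: "(line_norm s)\<^sup>2 = s\<^sup>2 + \<rho>\<^sup>2"
  unfolding line_norm_def by simp

lemma abs_le_line_norm: "\<bar>s\<bar> \<le> line_norm s"
  unfolding line_norm_def by (simp add: real_le_rsqrt)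

lemma line_norm_ge: "\<rho> \<le> line_norm s"
  unfolding line_norm_def by (simp add: real_le_rsqrt)

lemma line_log_ge_1: "line_log s \<ge> 1"
  using rho line_norm_ge[of s] unfolding line_log_def by simp

lemma continuous_on_line_norm [continuous_intros]: "continuous_on S line_norm"
  unfolding line_norm_def by (intro continuous_intros)

lemma continuous_on_line_log [continuous_intros]: "continuous_on S line_log"
  unfolding line_log_def using rho line_norm_pos
  by (intro continuous_intros) (auto simp: less_imp_neq[THEN not_sym])

lemma DERIV_line_norm: "(line_norm has_real_derivative s / line_norm s) (at s)"
proof -
  have "s\<^sup>2 + \<rho>\<^sup>2 > 0" using rho by (intro add_nonneg_pos) auto
  then show ?thesis
    unfolding line_norm_def by (auto intro!: derivative_eq_intros simp: divide_simps)
qed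

lemma DERIV_line_norm_log:
  "((\<lambda>s. line_norm s * line_log s) has_real_derivative s / line_norm s * (line_log s + 1)) (at s)"
  unfolding line_log_def
  by (rule derivative_eq_intros DERIV_line_norm refl | use rho line_norm_pos[of s] in \<open>simp add: field_simps\<close>)+

text \<open>With \<open>m = n - 2\<close> this is \<open>sin\<^sup>n\<^sup>-\<^sup>1 d\<close> times \<open>|cot d|\<^sup>n\<^sup>-\<^sup>2 cot d / (log (e / sin d))\<^sup>n\<^sup>-\<^sup>1\<close>, the meridional vector
  field on the sphere whose divergence is \<open>n - 1\<close> times the difference of the two weights.\<close>

definition "line_field m s = \<bar>s\<bar> ^ m * s / (line_norm s * line_log s) ^ (m + 1)"

text \<open>The quotient rule gives a numerator in which \<open>line_norm\<close> squared splits as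
  s^2 + \<rho>^2. What survives is \<rho>^2 L - s^2 with L = \<open>line_log s\<close>: the first
  term produces the weight \<open>Y\<close>, the second the weight \<open>X\<close>.\<close>

lemma DERIV_line_field:
  "(line_field m has_real_derivative
     (real m + 1) * \<bar>s\<bar> ^ m * (\<rho>\<^sup>2 * line_log s - s\<^sup>2)
       / (line_norm s * (line_norm s * line_log s) ^ (m + 2))) (at s)"
proof -
  let ?R = "line_norm s" and ?L = "line_log s"
  define Q where "Q = ?R * ?L"
  have R: "?R > 0" and L: "?L > 0" using line_norm_pos[of s] line_log_ge_1[of s] by auto
  then have Q: "Q > 0" by (simp add: Q_def)
  have "(line_field m has_real_derivative
     ((real m + 1) * \<bar>s\<bar> ^ m * Q ^ (m + 1)
       - \<bar>s\<bar> ^ m * s * ((real m + 1) * (Q ^ m * (s / ?R * (?L + 1)))))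
     / (Q ^ (m + 1) * Q ^ (m + 1))) (at s)"
    unfolding line_field_def
    by (rule DERIV_divide[THEN DERIV_cong, OF DERIV_abs_power_mult DERIV_power[OF DERIV_line_norm_log]])
       (use Q in \<open>auto simp: Q_def\<close>)
  also have "((real m + 1) * \<bar>s\<bar> ^ m * Q ^ (m + 1)
       - \<bar>s\<bar> ^ m * s * ((real m + 1) * (Q ^ m * (s / ?R * (?L + 1)))))
     / (Q ^ (m + 1) * Q ^ (m + 1)) =
     (real m + 1) * \<bar>s\<bar> ^ m * (Q - s\<^sup>2 / ?R * (?L + 1)) / Q ^ (m + 2)"
    using Q by (simp add: divide_simps power_add power2_eq_square) (simp add: algebra_simps)
  also have "Q - s\<^sup>2 / ?R * (?L + 1) = (\<rho>\<^sup>2 * ?L - s\<^sup>2) / ?R"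
  proof -
    have "Q * ?R = (s\<^sup>2 + \<rho>\<^sup>2) * ?L"
      using line_norm_sq[of s] by (simp add: Q_def power2_eq_square)
    then show ?thesis using R by (simp add: field_simps)
  qed
  finally show ?thesis by (simp add: Q_def)
qed

lemma line_log_at_infinity: "filterlim line_log at_top at_top" "filterlim line_log at_top at_bot"
proof -
  have l: "line_log s \<ge> 1 + ln (\<bar>s\<bar> / \<rho>)" if "s \<noteq> 0" for s
    unfolding line_log_def using that rho abs_le_line_norm[of s] by (simp add: divide_right_mono)
  have "filterlim (\<lambda>s. 1 + ln (\<bar>s\<bar> / \<rho>)) at_top at_infinity"
  proof -
    have "filterlim (\<lambda>s::real. (1 / \<rho>) * norm s) at_top at_infinity"
      using rho by (intro filterlim_tendsto_pos_mult_at_top[OF tendsto_const]) (auto simp: filterlim_norm_at_top simp del: real_norm_def)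
    then have "filterlim (\<lambda>s::real. ln (\<bar>s\<bar> / \<rho>)) at_top at_infinity"
      by (intro filterlim_compose[OF ln_at_top]) simp
    then show ?thesis
      by (intro filterlim_tendsto_add_at_top[OF tendsto_const])
  qed
  then have "filterlim line_log at_top at_infinity"
    by (rule filterlim_at_top_mono) (use l in \<open>auto simp: eventually_at_infinity intro!: exI[of _ 1]\<close>)
  then show "filterlim line_log at_top at_top" "filterlim line_log at_top at_bot"
    using at_top_le_at_infinity at_bot_le_at_infinity by (auto intro: filterlim_mono)
qed

text \<open>The bound |s| \<le> \<open>line_norm s\<close> removes the algebraic factor, and L \<ge>
  1 allows all but one power of L to be dropped. The remaining one makes the boundary terms
  vanish.\<close>

lemma abs_line_field_le: "\<bar>line_field m s\<bar> \<le> 1 / line_log s"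
proof -
  let ?R = "line_norm s" and ?L = "line_log s"
  have R: "?R > 0" and L: "?L \<ge> 1" using line_norm_pos line_log_ge_1 by auto
  have "\<bar>line_field m s\<bar> = (\<bar>s\<bar> / ?R) ^ (m + 1) / ?L ^ (m + 1)"
    using R L by (simp add: line_field_def abs_mult power_mult_distrib power_divide mult_ac)
  also have "\<dots> \<le> 1 / ?L"
  proof (rule frac_le)
    show "(\<bar>s\<bar> / ?R) ^ (m + 1) \<le> 1"
      using R abs_le_line_norm[of s] by (intro power_le_one) auto
    show "?L \<le> ?L ^ (m + 1)" using L by (simp add: self_le_power)
  qed (use L in auto)
  finally show ?thesis .
qed

text \<open>The term with factor \<open>a ^ (m + 1) * \<rho>\<close> is that multiple of the
  derivative of \<open>|f|^(m+2) * line_field m\<close>. With n = m + 2, \<open>M\<close> is the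
  cylinder weight of power n + 1. The bound on \<open>f'\<close> is the one satisfied along a
  meridian traversed at speed \<rho> / R^2, R = \<open>line_norm s\<close>, if \<open>G\<close> is
  the length of the gradient.\<close>

lemma line_hardy_pointwise:
  fixes f f' G s :: real and m :: nat
  assumes G: "0 \<le> G" and f': "\<bar>f'\<bar> \<le> G * \<rho> / (line_norm s)\<^sup>2"
  defines "a \<equiv> (real m + 1) / (real m + 2)"
    and "M \<equiv> (\<rho> / line_norm s) ^ (m + 3)"
    and "X \<equiv> \<bar>f\<bar> ^ (m + 2) * (\<bar>s\<bar> / \<rho>) ^ (m + 2) / line_log s ^ (m + 2)"
    and "Y \<equiv> \<bar>f\<bar> ^ (m + 2) * (\<bar>s\<bar> / \<rho>) ^ m / line_log s ^ (m + 1)"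
  shows "a ^ (m + 2) * X * M + a ^ (m + 1) * \<rho> *
     (\<bar>f\<bar> ^ (m + 2) * ((real m + 1) * \<bar>s\<bar> ^ m * (\<rho>\<^sup>2 * line_log s - s\<^sup>2)
         / (line_norm s * (line_norm s * line_log s) ^ (m + 2)))
       + (real m + 2) * (\<bar>f\<bar> ^ m * f) * f' * line_field m s)
     \<le> (G ^ (m + 2) + (real m + 1) * a ^ (m + 1) * Y) * M"
proof -
  let ?R = "line_norm s" and ?L = "line_log s"
  \<comment> \<open>Chosen so that the chain rule term is at most
    \<open>(m + 2) * G * B ^ (m + 1) * M\<close>, the left side of Young's inequality, while
    \<open>B ^ (m + 2)\<close> is \<open>a ^ (m + 2) * X\<close>.\<close>
  define B where "B = a * (\<bar>f\<bar> * (\<bar>s\<bar> / \<rho>) / ?L)"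
  have R: "?R > 0" and L: "?L > 0" using line_norm_pos[of s] line_log_ge_1[of s] by auto
  have a: "a > 0" "(real m + 2) * a = real m + 1" by (auto simp: a_def)
  have M: "M > 0" using R rho by (simp add: M_def)
  have B: "B \<ge> 0" using a L rho by (simp add: B_def)
  have BX: "B ^ (m + 2) = a ^ (m + 2) * X"
    by (simp only: B_def X_def power_mult_distrib power_divide times_divide_eq_right)
  \<comment> \<open>The part in which the field is differentiated yields the difference of the
    weights exactly.\<close>
  have one: "\<rho> * (\<bar>f\<bar> ^ (m + 2) * ((real m + 1) * \<bar>s\<bar> ^ m * (\<rho>\<^sup>2 * ?L - s\<^sup>2)
         / (?R * (?R * ?L) ^ (m + 2)))) = (real m + 1) * (Y - X) * M"
  proof -
    have "(Y - X) * M = \<bar>f\<bar> ^ (m + 2) * ((\<bar>s\<bar> ^ m * \<rho>\<^sup>2 * ?L - \<bar>s\<bar> ^ (m + 2)) / (\<rho> ^ (m + 2) * ?L ^ (m + 2))) * M"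
      using R L rho unfolding X_def Y_def
      by (simp add: power_divide divide_simps power_add power2_eq_square) (simp add: algebra_simps)
    also have "\<dots> = \<bar>f\<bar> ^ (m + 2) * (\<bar>s\<bar> ^ m * \<rho>\<^sup>2 * ?L - \<bar>s\<bar> ^ (m + 2)) * \<rho> / (?R * (?R * ?L) ^ (m + 2))"
      using R L rho unfolding M_def
      by (simp add: power_divide power_mult_distrib divide_simps power_add power3_eq_cube power2_eq_square)
    also have "\<bar>s\<bar> ^ m * \<rho>\<^sup>2 * ?L - \<bar>s\<bar> ^ (m + 2) = \<bar>s\<bar> ^ m * (\<rho>\<^sup>2 * ?L - s\<^sup>2)"
      by (simp only: power_add power2_abs) (simp only: right_diff_distrib mult.assoc)
    finally have eq: "(Y - X) * M = \<bar>f\<bar> ^ (m + 2) * (\<bar>s\<bar> ^ m * (\<rho>\<^sup>2 * ?L - s\<^sup>2)) * \<rho> / (?R * (?R * ?L) ^ (m + 2))" .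
    show ?thesis
      unfolding mult.assoc[of _ "Y - X"] eq by (simp only: times_divide_eq_right mult_ac)
  qed
  \<comment> \<open>The part in which \<open>f\<close> is differentiated has no sign; it is
    estimated by its absolute value and Young's inequality.\<close>
  have two: "a ^ (m + 1) * \<rho> * ((real m + 2) * (\<bar>f\<bar> ^ m * f) * f' * line_field m s)
      \<le> (G ^ (m + 2) + (real m + 1) * (a ^ (m + 2) * X)) * M"
  proof -
    have "a ^ (m + 1) * \<rho> * ((real m + 2) * (\<bar>f\<bar> ^ m * f) * f' * line_field m s)
      \<le> a ^ (m + 1) * \<rho> * \<bar>(real m + 2) * (\<bar>f\<bar> ^ m * f) * f' * line_field m s\<bar>"
      using a rho by (intro mult_left_mono abs_ge_self) auto
    also have "\<dots> = a ^ (m + 1) * \<rho> * ((real m + 2) * \<bar>f\<bar> ^ (m + 1) * \<bar>line_field m s\<bar>) * \<bar>f'\<bar>"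
      by (simp add: abs_mult power_add mult_ac)
    also have "\<dots> \<le> a ^ (m + 1) * \<rho> * ((real m + 2) * \<bar>f\<bar> ^ (m + 1) * \<bar>line_field m s\<bar>) * (G * \<rho> / ?R\<^sup>2)"
      using a rho f' by (intro mult_left_mono) auto
    also have "\<bar>line_field m s\<bar> = \<bar>s\<bar> ^ (m + 1) / (?R * ?L) ^ (m + 1)"
      using R L by (simp add: line_field_def abs_mult power_mult_distrib)
    also have "a ^ (m + 1) * \<rho> * ((real m + 2) * \<bar>f\<bar> ^ (m + 1) * (\<bar>s\<bar> ^ (m + 1) / (?R * ?L) ^ (m + 1))) * (G * \<rho> / ?R\<^sup>2)
       = (real (m + 1) + 1) * G * B ^ (m + 1) * M"
      using R L rho unfolding B_def M_def
      by (simp add: power_divide power_mult_distrib divide_simps power_add power3_eq_cube power2_eq_square)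
    also have "\<dots> \<le> (G ^ (m + 2) + (real m + 1) * B ^ (m + 2)) * M"
      using Youngs_inequality_power[OF G B, of "m + 1"] M
      by (intro mult_right_mono) (simp_all add: add_ac)
    finally show ?thesis by (simp only: BX)
  qed
  \<comment> \<open>This fixes \<open>a\<close>: the derivative supplies -(m + 2) copies of
    \<open>a ^ (m + 2) * X\<close>, Young's inequality takes up m + 1 of them, and exactly the one
    on the left side remains.\<close>
  have "(real m + 1) * a ^ (m + 1) = (real m + 2) * a ^ (m + 2)"
    by (simp only: a(2)[symmetric]) simp
  then have "(real m + 1) * a ^ (m + 1) * X * M = (real m + 2) * a ^ (m + 2) * X * M"
    by (simp only:)
  then have "a ^ (m + 1) * ((real m + 1) * (Y - X) * M)
     = (real m + 1) * a ^ (m + 1) * Y * M - (real m + 2) * a ^ (m + 2) * X * M"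
    by (simp add: algebra_simps)
  then have "a ^ (m + 2) * X * M + a ^ (m + 1) * ((real m + 1) * (Y - X) * M)
      + (G ^ (m + 2) + (real m + 1) * (a ^ (m + 2) * X)) * M
      = (G ^ (m + 2) + (real m + 1) * a ^ (m + 1) * Y) * M"
    by (simp add: algebra_simps)
  moreover have "a ^ (m + 1) * \<rho> *
     (\<bar>f\<bar> ^ (m + 2) * ((real m + 1) * \<bar>s\<bar> ^ m * (\<rho>\<^sup>2 * ?L - s\<^sup>2)
         / (?R * (?R * ?L) ^ (m + 2)))
       + (real m + 2) * (\<bar>f\<bar> ^ m * f) * f' * line_field m s)
     = a ^ (m + 1) * ((real m + 1) * (Y - X) * M)
       + a ^ (m + 1) * \<rho> * ((real m + 2) * (\<bar>f\<bar> ^ m * f) * f' * line_field m s)"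
    unfolding one[symmetric] by (simp only: distrib_left mult.assoc)
  ultimately show ?thesis using two by linarith
qed

text \<open>Integration of \<open>line_hardy_pointwise\<close>; boundedness of \<open>f\<close>
  together with the growth of \<open>line_log\<close> removes the boundary terms.\<close>

lemma line_hardy:
  fixes f f' G :: "real \<Rightarrow> real" and m :: nat
  assumes f: "\<And>s. (f has_real_derivative f' s) (at s)" "continuous_on UNIV f'"
    and bdd: "\<And>s. \<bar>f s\<bar> \<le> K"
    and G: "continuous_on UNIV G" "\<And>s. 0 \<le> G s"
    and f': "\<And>s. \<bar>f' s\<bar> \<le> G s * \<rho> / (line_norm s)\<^sup>2"
  defines "a \<equiv> (real m + 1) / (real m + 2)"
  shows "(\<integral>\<^sup>+s. ennreal (a ^ (m + 2) * (\<bar>f s\<bar> ^ (m + 2) * (\<bar>s\<bar> / \<rho>) ^ (m + 2) / line_log s ^ (m + 2))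
            * (\<rho> / line_norm s) ^ (m + 3)) \<partial>lborel)
    \<le> (\<integral>\<^sup>+s. ennreal ((G s ^ (m + 2)
            + (real m + 1) * a ^ (m + 1) * (\<bar>f s\<bar> ^ (m + 2) * (\<bar>s\<bar> / \<rho>) ^ m / line_log s ^ (m + 1)))
            * (\<rho> / line_norm s) ^ (m + 3)) \<partial>lborel)"
proof -
  have L: "line_log s > 0" "line_log s \<noteq> 0" and R: "line_norm s > 0" "line_norm s \<noteq> 0" for s
    using line_log_ge_1[of s] line_norm_pos[of s] by auto
  have cf: "continuous_on UNIV f"
    using f(1) by (meson DERIV_isCont continuous_at_imp_continuous_on)
  have cfield: "continuous_on UNIV (line_field m)"
    using DERIV_line_field by (meson DERIV_isCont continuous_at_imp_continuous_on)
  have K: "K \<ge> 0" using bdd[of 0] by linarith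
  define P where "P = (\<lambda>s. a ^ (m + 1) * \<rho> * (\<bar>f s\<bar> ^ (m + 2) * line_field m s))"
  \<comment> \<open>Stated for an arbitrary filter so that both ends of the line are treated at
    once.\<close>
  have lim: "(P \<longlongrightarrow> 0) F" if "filterlim line_log at_top F" for F
  proof (rule Lim_null_comparison)
    show "eventually (\<lambda>s. norm (P s) \<le> a ^ (m + 1) * \<rho> * K ^ (m + 2) * inverse (line_log s)) F"
    proof (rule always_eventually, rule allI)
      fix s
      have "\<bar>f s\<bar> ^ (m + 2) * \<bar>line_field m s\<bar> \<le> K ^ (m + 2) * inverse (line_log s)"
        using bdd K abs_line_field_le[of m s] L[of s]
        by (intro mult_mono power_mono) (auto simp: divide_inverse)
      then show "norm (P s) \<le> a ^ (m + 1) * \<rho> * K ^ (m + 2) * inverse (line_log s)"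
        using rho by (simp add: P_def a_def abs_mult mult.assoc mult_left_mono del: power_Suc)
    qed
    have "((\<lambda>s. inverse (line_log s)) \<longlongrightarrow> 0) F"
      using that by (rule tendsto_inverse_0_at_top)
    from tendsto_mult_right_zero[OF this]
    show "((\<lambda>s. a ^ (m + 1) * \<rho> * K ^ (m + 2) * inverse (line_log s)) \<longlongrightarrow> 0) F" .
  qed
  show ?thesis
  proof (rule nn_integral_le_of_null_boundary[where P = P])
    show "(P has_real_derivative a ^ (m + 1) * \<rho> *
     (\<bar>f s\<bar> ^ (m + 2) * ((real m + 1) * \<bar>s\<bar> ^ m * (\<rho>\<^sup>2 * line_log s - s\<^sup>2)
         / (line_norm s * (line_norm s * line_log s) ^ (m + 2)))
       + (real m + 2) * (\<bar>f s\<bar> ^ m * f s) * f' s * line_field m s)) (at s)" for s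
      unfolding P_def
      by (rule DERIV_cmult DERIV_cong[OF DERIV_mult[OF DERIV_chain2[OF DERIV_abs_power f(1)] DERIV_line_field]])+
         (simp add: algebra_simps)
    show "a ^ (m + 2) * (\<bar>f s\<bar> ^ (m + 2) * (\<bar>s\<bar> / \<rho>) ^ (m + 2) / line_log s ^ (m + 2))
            * (\<rho> / line_norm s) ^ (m + 3) + a ^ (m + 1) * \<rho> *
     (\<bar>f s\<bar> ^ (m + 2) * ((real m + 1) * \<bar>s\<bar> ^ m * (\<rho>\<^sup>2 * line_log s - s\<^sup>2)
         / (line_norm s * (line_norm s * line_log s) ^ (m + 2)))
       + (real m + 2) * (\<bar>f s\<bar> ^ m * f s) * f' s * line_field m s)
      \<le> (G s ^ (m + 2)
            + (real m + 1) * a ^ (m + 1) * (\<bar>f s\<bar> ^ (m + 2) * (\<bar>s\<bar> / \<rho>) ^ m / line_log s ^ (m + 1)))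
            * (\<rho> / line_norm s) ^ (m + 3)" for s
      unfolding a_def by (rule line_hardy_pointwise[OF G(2) f'])
    show "(P \<longlongrightarrow> 0) at_top" "(P \<longlongrightarrow> 0) at_bot"
      using lim line_log_at_infinity by auto
  qed (use rho L(1) R(1) G(2) in \<open>auto simp: a_def L(2) R(2) less_imp_le simp del: power_Suc intro!: continuous_intros cf cfield f(2) G(1)\<close>)
qed

end

section \<open>Integration over the sphere along meridians\<close>

lemma nn_integral_lborel_scaleR:
  fixes f :: "'a::euclidean_space \<Rightarrow> ennreal"
  assumes [measurable]: "f \<in> borel_measurable borel" and c: "c > 0"
  shows "(\<integral>\<^sup>+x. f x \<partial>lborel) = ennreal (c ^ DIM('a)) * (\<integral>\<^sup>+x. f (c *\<^sub>R x) \<partial>lborel)"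
  by (subst lborel_affine[of c 0])
     (use c in \<open>simp_all add: nn_integral_density nn_integral_distr nn_integral_cmult\<close>)

lemma nn_integral_lborel_translate:
  fixes f :: "'a::euclidean_space \<Rightarrow> ennreal"
  assumes [measurable]: "f \<in> borel_measurable borel"
  shows "(\<integral>\<^sup>+x. f (c + x) \<partial>lborel) = (\<integral>\<^sup>+x. f x \<partial>lborel)"
  by (subst (2) lborel_distr_plus[symmetric, of c]) (simp add: nn_integral_distr)

text \<open>Both sides average \<open>F |x|\<^sup>-\<^sup>N\<close> over dilations: a homogeneous weight integrates to the same constant
  along every ray, whichever gauge is used to cut the ray off.\<close>

lemma nn_integral_ball_eq_gauge:
  fixes F :: "'a::euclidean_space \<Rightarrow> ennreal" and q :: "'a \<Rightarrow> real"
  assumes [measurable]: "F \<in> borel_measurable borel" "q \<in> borel_measurable borel"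
    and F: "\<And>t x. t > 0 \<Longrightarrow> F (t *\<^sub>R x) = F x"
    and q: "\<And>t x. t > 0 \<Longrightarrow> q (t *\<^sub>R x) = t * q x"
    and pos: "AE x in lborel. q x > 0"
  shows "(\<integral>\<^sup>+x. F x * indicator (ball 0 1 - {0}) x \<partial>lborel)
    = (\<integral>\<^sup>+x. F x * (ennreal ((q x / norm x) ^ DIM('a)) * indicator {0<..1} (q x)) \<partial>lborel)"
proof -
  define N where "N = DIM('a)"
  have N: "N > 0" by (simp add: N_def)
  then obtain k where k: "N = Suc k" by (metis gr0_conv_Suc)
  \<comment> \<open>As a function of t this is the derivative of \<open>(t * q x) ^ N\<close>, cut
    off where \<open>t * q x\<close> exceeds 1, hence a probability density whenever
    \<open>q x > 0\<close>.\<close>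
  define K where "K t x = ennreal (real N * (t * q x) ^ k * q x) * indicator {0<..1} (t * q x)
    * indicator {0<..} t" for t x
  have [measurable]: "(\<lambda>t. K t x) \<in> borel_measurable borel" for x
    unfolding K_def by measurable
  have K1: "(\<integral>\<^sup>+t. K t x \<partial>lborel) = 1" if "q x > 0" for x
  proof -
    have "(\<integral>\<^sup>+t. K t x \<partial>lborel) = (\<integral>\<^sup>+t. ennreal (real N * (t * q x) ^ k * q x) * indicator {0..1 / q x} t \<partial>lborel)"
      by (rule nn_integral_cong_AE, rule AE_mp[OF AE_lborel_singleton[of 0]], rule AE_I2)
         (use that in \<open>auto simp: K_def pos_le_divide_eq zero_less_mult_iff split: split_indicator\<close>)
    also have "\<dots> = ennreal ((1 / q x * q x) ^ N - (0 * q x) ^ N)"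
      proof (rule nn_integral_FTC_Icc)
      show "((\<lambda>t. (t * q x) ^ N) has_real_derivative real N * (t * q x) ^ k * q x) (at t)" for t
        by (rule DERIV_cong[OF DERIV_chain2[OF DERIV_pow DERIV_cmult_right[OF DERIV_ident]]]) (simp add: k)
    qed (use that in auto)
    finally show ?thesis using that N by simp
  qed
  \<comment> \<open>Under x = z / t the kernel retains only a factor 1 / t, which the Jacobian
    completes to the power N + 1. The cut-off by the ball becomes |z| < t, and that by
    \<open>q\<close> no longer involves t.\<close>
  have K2: "K t ((1 / t) *\<^sub>R z) = ennreal (real N * q z ^ N / t) * indicator {0<..1} (q z)" if "t > 0" for t z
    using that q[of "1 / t" z] by (simp add: K_def k mult_ac)
  have "(\<integral>\<^sup>+x. F x * indicator (ball 0 1 - {0}) x \<partial>lborel)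
      = (\<integral>\<^sup>+x. \<integral>\<^sup>+t. F x * indicator (ball 0 1 - {0}) x * K t x \<partial>lborel \<partial>lborel)"
    by (rule nn_integral_cong_AE, rule AE_mp[OF pos], rule AE_I2)
       (simp add: nn_integral_cmult K1)
  also have "\<dots> = (\<integral>\<^sup>+t. \<integral>\<^sup>+x. F x * indicator (ball 0 1 - {0}) x * K t x \<partial>lborel \<partial>lborel)"
    by (intro lborel_pair.Fubini'[symmetric]) (simp add: split_beta' K_def indicator_def of_bool_def)
  also have "\<dots> = (\<integral>\<^sup>+t. \<integral>\<^sup>+z. F z * indicator {0<..1} (q z) * ennreal (q z ^ N)
      * (ennreal (real N / t ^ (N + 1)) * indicator {0<..} t * indicator {0<..<t} (norm z)) \<partial>lborel \<partial>lborel)"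
  proof (rule nn_integral_cong)
    fix t :: real
    show "(\<integral>\<^sup>+x. F x * indicator (ball 0 1 - {0}) x * K t x \<partial>lborel)
      = (\<integral>\<^sup>+z. F z * indicator {0<..1} (q z) * ennreal (q z ^ N)
      * (ennreal (real N / t ^ (N + 1)) * indicator {0<..} t * indicator {0<..<t} (norm z)) \<partial>lborel)"
    proof (cases "t > 0")
      case True
      have "(\<integral>\<^sup>+x. F x * indicator (ball 0 1 - {0}) x * K t x \<partial>lborel)
        = ennreal ((1 / t) ^ N) * (\<integral>\<^sup>+z. F ((1 / t) *\<^sub>R z) * indicator (ball 0 1 - {0}) ((1 / t) *\<^sub>R z)
            * K t ((1 / t) *\<^sub>R z) \<partial>lborel)"
        unfolding N_def by (rule nn_integral_lborel_scaleR) (simp_all add: K_def True indicator_def of_bool_def)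
      also have "\<dots> = (\<integral>\<^sup>+z. ennreal ((1 / t) ^ N) * (F z * indicator {0<..<t} (norm z)
            * (ennreal (real N * q z ^ N / t) * indicator {0<..1} (q z))) \<partial>lborel)"
      proof -
        have "indicator (ball 0 1 - {0}) ((1 / t) *\<^sub>R z) = (indicator {0<..<t} (norm z) :: ennreal)" for z :: 'a
          using True by (auto simp: indicator_def)
        moreover have "F ((1 / t) *\<^sub>R z) = F z" for z
          using True by (intro F) simp
        ultimately show ?thesis
          by (simp only: K2[OF True]) (simp add: nn_integral_cmult)
      qed
      also have "\<dots> = (\<integral>\<^sup>+z. F z * indicator {0<..1} (q z) * ennreal (q z ^ N)
      * (ennreal (real N / t ^ (N + 1)) * indicator {0<..} t * indicator {0<..<t} (norm z)) \<partial>lborel)"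
      proof (rule nn_integral_cong)
        fix z :: 'a
        have "ennreal ((1 / t) ^ N) * ennreal (real N * q z ^ N / t)
            = ennreal (q z ^ N) * ennreal (real N / t ^ (N + 1))" if "q z > 0"
          using that True by (simp add: ennreal_mult[symmetric] power_divide field_simps)
        then show "ennreal ((1 / t) ^ N) * (F z * indicator {0<..<t} (norm z)
            * (ennreal (real N * q z ^ N / t) * indicator {0<..1} (q z)))
          = F z * indicator {0<..1} (q z) * ennreal (q z ^ N)
      * (ennreal (real N / t ^ (N + 1)) * indicator {0<..} t * indicator {0<..<t} (norm z))"
          using True by (auto simp: mult_ac split: split_indicator)
      qed
      finally show ?thesis .
    qed (simp add: K_def)
  qed
  also have "\<dots> = (\<integral>\<^sup>+z. \<integral>\<^sup>+t. F z * indicator {0<..1} (q z) * ennreal (q z ^ N)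
      * (ennreal (real N / t ^ (N + 1)) * indicator {0<..} t * indicator {0<..<t} (norm z)) \<partial>lborel \<partial>lborel)"
    by (intro lborel_pair.Fubini') (simp add: split_beta' indicator_def of_bool_def)
  also have "\<dots> = (\<integral>\<^sup>+z. F z * (ennreal ((q z / norm z) ^ N) * indicator {0<..1} (q z)) \<partial>lborel)"
  proof (rule nn_integral_cong_AE, rule AE_mp[OF AE_lborel_singleton[of 0]], rule AE_I2, rule impI)
    fix z :: 'a assume "z \<noteq> 0"
    then have z0: "norm z > 0" by simp
    \<comment> \<open>Adding the null set t = |z| gives a closed ray for the fundamental theorem.
      Its value |z|^(-N) turns \<open>q z ^ N\<close> into
      \<open>(q z / norm z) ^ N\<close>.\<close>
    have "(\<integral>\<^sup>+t. ennreal (real N / t ^ (N + 1)) * indicator {0<..} t * indicator {0<..<t} (norm z) \<partial>lborel)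
        = (\<integral>\<^sup>+t. ennreal (real N / t ^ (N + 1)) * indicator {norm z..} t \<partial>lborel)"
      by (rule nn_integral_cong_AE, rule AE_mp[OF AE_lborel_singleton[of "norm z"]], rule AE_I2)
         (use z0 in \<open>auto simp del: zero_less_norm_iff split: split_indicator\<close>)
    also have "\<dots> = 0 - (- inverse (norm z ^ N))"
    proof (rule nn_integral_FTC_atLeast)
      show "((\<lambda>t. - inverse (t ^ N)) has_real_derivative real N / t ^ (N + 1)) (at t)" if "norm z \<le> t" for t
      proof -
        have t: "t > 0" using that z0 by linarith
        show ?thesis
          by (rule DERIV_cong[OF DERIV_minus[OF DERIV_inverse_fun[OF DERIV_pow]]])
             (use t in \<open>simp_all add: k divide_simps power_add\<close>)
      qed
      show "0 \<le> real N / t ^ (N + 1)" if "norm z \<le> t" for t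
        using that by (intro divide_nonneg_nonneg zero_le_power) (auto intro: order_trans[OF norm_ge_zero])
      have "((\<lambda>t. - inverse (t ^ N)) \<longlongrightarrow> - 0) (at_top :: real filter)"
        using N by (intro tendsto_intros tendsto_inverse_0_at_top filterlim_pow_at_top filterlim_ident) auto
      then show "((\<lambda>t. - inverse (t ^ N)) \<longlongrightarrow> 0) (at_top :: real filter)" by simp
    qed auto
    finally have int: "(\<integral>\<^sup>+t. ennreal (real N / t ^ (N + 1)) * indicator {0<..} t * indicator {0<..<t} (norm z) \<partial>lborel)
        = ennreal (inverse (norm z ^ N))" by simp
    have "(\<lambda>t. ennreal (real N / t ^ (N + 1)) * indicator {0<..} t * indicator {0<..<t} (norm z))
        \<in> borel_measurable lborel"
      by (simp add: indicator_def of_bool_def)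
    note cmult = nn_integral_cmult[OF this]
    have "ennreal (q z ^ N) * ennreal (inverse (norm z ^ N)) = ennreal ((q z / norm z) ^ N)"
      if "q z > 0"
      using that by (simp add: ennreal_mult[symmetric] power_inverse power_mult_distrib divide_inverse)
    then show "(\<integral>\<^sup>+t. F z * indicator {0<..1} (q z) * ennreal (q z ^ N)
      * (ennreal (real N / t ^ (N + 1)) * indicator {0<..} t * indicator {0<..<t} (norm z)) \<partial>lborel)
      = F z * (ennreal ((q z / norm z) ^ N) * indicator {0<..1} (q z))"
      unfolding cmult int by (auto simp: mult_ac split: split_indicator)
  qed
  finally show ?thesis by (simp add: N_def)
qed

text \<open>Avoids an orthogonal splitting of the space along \<open>e\<close>: the unit slab replaces the hyperplane.\<close>

lemma nn_integral_lborel_lines: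
  fixes G :: "'a::euclidean_space \<Rightarrow> ennreal"
  assumes [measurable]: "G \<in> borel_measurable borel" and e: "norm e = 1"
  shows "(\<integral>\<^sup>+x. G x \<partial>lborel)
    = (\<integral>\<^sup>+x. indicator {0..1} (x \<bullet> e) * (\<integral>\<^sup>+t. G (x - (x \<bullet> e) *\<^sub>R e + t *\<^sub>R e) \<partial>lborel) \<partial>lborel)"
proof -
  have ee: "e \<bullet> e = 1" using e by (simp add: norm_eq_1)
  have "(\<integral>\<^sup>+x. indicator {0..1} (x \<bullet> e) * (\<integral>\<^sup>+t. G (x - (x \<bullet> e) *\<^sub>R e + t *\<^sub>R e) \<partial>lborel) \<partial>lborel)
    = (\<integral>\<^sup>+x. \<integral>\<^sup>+t. indicator {0..1} (x \<bullet> e) * G (x + t *\<^sub>R e) \<partial>lborel \<partial>lborel)"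
  proof (rule nn_integral_cong)
    fix x :: 'a
    \<comment> \<open>Shifting t by \<open>x \<bullet> e\<close> absorbs the projection onto the
      hyperplane.\<close>
    have "(\<integral>\<^sup>+t. G (x - (x \<bullet> e) *\<^sub>R e + t *\<^sub>R e) \<partial>lborel) = (\<integral>\<^sup>+t. G (x + t *\<^sub>R e) \<partial>lborel)"
      using nn_integral_lborel_translate[of "\<lambda>t. G (x - (x \<bullet> e) *\<^sub>R e + t *\<^sub>R e)" "x \<bullet> e"]
      by (simp add: algebra_simps)
    then show "indicator {0..1} (x \<bullet> e) * (\<integral>\<^sup>+t. G (x - (x \<bullet> e) *\<^sub>R e + t *\<^sub>R e) \<partial>lborel)
        = (\<integral>\<^sup>+t. indicator {0..1} (x \<bullet> e) * G (x + t *\<^sub>R e) \<partial>lborel)"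
      by (simp add: nn_integral_cmult)
  qed
  also have "\<dots> = (\<integral>\<^sup>+t. \<integral>\<^sup>+x. indicator {0..1} (x \<bullet> e) * G (x + t *\<^sub>R e) \<partial>lborel \<partial>lborel)"
    by (intro lborel_pair.Fubini'[symmetric]) (simp add: split_beta')
  also have "\<dots> = (\<integral>\<^sup>+t. \<integral>\<^sup>+x. indicator {0..1} (x \<bullet> e - t) * G x \<partial>lborel \<partial>lborel)"
  proof (rule nn_integral_cong)
    fix t :: real
    show "(\<integral>\<^sup>+x. indicator {0..1} (x \<bullet> e) * G (x + t *\<^sub>R e) \<partial>lborel)
        = (\<integral>\<^sup>+x. indicator {0..1} (x \<bullet> e - t) * G x \<partial>lborel)"
      using nn_integral_lborel_translate[of "\<lambda>x. indicator {0..1} (x \<bullet> e - t) * G x" "t *\<^sub>R e"] ee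
      by (simp add: inner_add_left add.commute)
  qed
  also have "\<dots> = (\<integral>\<^sup>+x. \<integral>\<^sup>+t. indicator {0..1} (x \<bullet> e - t) * G x \<partial>lborel \<partial>lborel)"
    by (intro lborel_pair.Fubini') (simp add: split_beta')
  \<comment> \<open>For fixed x, the shifts t whose slab contains x form an interval of length
    1.\<close>
  also have "\<dots> = (\<integral>\<^sup>+x. G x \<partial>lborel)"
  proof (rule nn_integral_cong)
    fix x :: 'a
    have "(\<integral>\<^sup>+t. indicator {0..1} (x \<bullet> e - t) * G x \<partial>lborel)
        = (\<integral>\<^sup>+t. G x * indicator {x \<bullet> e - 1..x \<bullet> e} t \<partial>lborel)"
      by (intro nn_integral_cong) (auto split: split_indicator)
    then show "(\<integral>\<^sup>+t. indicator {0..1} (x \<bullet> e - t) * G x \<partial>lborel) = G x"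
      by (simp add: nn_integral_cmult)
  qed
  finally show ?thesis by simp
qed

section \<open>Surface integrals computed on the cylinder around an axis\<close>

lemma AE_norm_perp_pos:
  fixes e :: "'a::euclidean_space"
  assumes "DIM('a) \<ge> 2"
  shows "AE x in lborel. norm (x - (x \<bullet> e) *\<^sub>R e) > 0"
proof -
  \<comment> \<open>The exceptional points lie in a subspace of dimension at most 1, a null set in
    dimension at least 2.\<close>
  have "dim (span {e}) \<le> 1" by (simp add: dim_insert)
  then have "negligible (span {e})" using assms by (intro negligible_lowdim) linarith
  moreover have "closed (span {e})" by (rule closed_subspace) simp
  ultimately have "span {e} \<in> null_sets lborel"
    by (auto simp: negligible_iff_null_sets null_sets_completion_iff)
  moreover have "x \<in> span {e}" if "norm (x - (x \<bullet> e) *\<^sub>R e) = 0" for x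
  proof -
    have "x = (x \<bullet> e) *\<^sub>R e" using that by simp
    then show ?thesis by (metis span_base insertI1 span_scale)
  qed
  ultimately show ?thesis
    by (intro AE_I'[of "span {e}"]) auto
qed

text \<open>\<open>F\<close> extends \<open>h\<close> to be constant on rays, with value 0 at the
  origin. The cone measure integrates it over the ball, and the gauge \<open>q\<close>, for unit
  \<open>e\<close> the distance from the axis, replaces the ball by the cylinder.\<close>

lemma nn_integral_sphere_measure:
  fixes h :: "'a::euclidean_space \<Rightarrow> ennreal" and e :: 'a
  assumes h: "h \<in> borel_measurable (restrict_space borel (sphere 0 1))"
    and dim: "DIM('a) \<ge> 2"
  defines "F \<equiv> \<lambda>x. h (x /\<^sub>R norm x) * indicator (- {0}) x"
    and "q \<equiv> \<lambda>x. norm (x - (x \<bullet> e) *\<^sub>R e)"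
  shows "F \<in> borel_measurable borel"
    and "(\<integral>\<^sup>+x. h x \<partial>sphere_measure)
      = of_nat DIM('a) * (\<integral>\<^sup>+x. F x * (ennreal ((q x / norm x) ^ DIM('a)) * indicator {0<..1} (q x)) \<partial>lborel)"
proof -
  have "(\<lambda>x. x /\<^sub>R norm x) \<in> restrict_space borel (- {0}) \<rightarrow>\<^sub>M restrict_space borel (sphere 0 1 :: 'a set)"
    by (rule measurable_restrict_space3) auto
  from measurable_compose[OF this h] show F: "F \<in> borel_measurable borel"
    unfolding F_def by (subst (asm) borel_measurable_restrict_space_iff_ennreal) auto
  have "(\<integral>\<^sup>+x. h x \<partial>sphere_measure) = of_nat DIM('a) * (\<integral>\<^sup>+x. h (x /\<^sub>R norm x) * indicator (ball 0 1 - {0}) x \<partial>lborel)"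
    unfolding sphere_measure_def using h
    by (simp add: nn_integral_scale_measure nn_integral_distr[OF measurable_radial_projection]
        nn_integral_restrict_space)
  also have "(\<integral>\<^sup>+x. h (x /\<^sub>R norm x) * indicator (ball 0 1 - {0}) x \<partial>lborel)
      = (\<integral>\<^sup>+x. F x * indicator (ball 0 1 - {0}) x \<partial>lborel)"
    by (intro nn_integral_cong) (auto simp: F_def split: split_indicator)
  also have "\<dots> = (\<integral>\<^sup>+x. F x * (ennreal ((q x / norm x) ^ DIM('a)) * indicator {0<..1} (q x)) \<partial>lborel)"
  proof (rule nn_integral_ball_eq_gauge[OF F])
    show "q \<in> borel_measurable borel" unfolding q_def by measurable
    show "F (t *\<^sub>R x) = F x" if "t > 0" for t x
    proof -
      have "(t *\<^sub>R x) /\<^sub>R norm (t *\<^sub>R x) = x /\<^sub>R norm x" using that by simp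
      then show ?thesis using that by (simp only: F_def) (simp add: indicator_def)
    qed
    show "q (t *\<^sub>R x) = t * q x" if "t > 0" for t x
    proof -
      have "t *\<^sub>R x - (t *\<^sub>R x \<bullet> e) *\<^sub>R e = t *\<^sub>R (x - (x \<bullet> e) *\<^sub>R e)"
        by (simp add: algebra_simps)
      then show ?thesis using that by (simp add: q_def)
    qed
    show "AE x in lborel. q x > 0" unfolding q_def by (rule AE_norm_perp_pos[OF dim])
  qed
  finally show "(\<integral>\<^sup>+x. h x \<partial>sphere_measure)
      = of_nat DIM('a) * (\<integral>\<^sup>+x. F x * (ennreal ((q x / norm x) ^ DIM('a)) * indicator {0<..1} (q x)) \<partial>lborel)" .
qed

text \<open>Fubini along lines parallel to \<open>e\<close> presents both integrals as averages,
  with the same nonnegative weight, of the line integrals being compared.\<close>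

lemma nn_integral_sphere_mono_meridians:
  fixes h1 h2 :: "'a::euclidean_space \<Rightarrow> ennreal" and e :: 'a
  assumes h1: "h1 \<in> borel_measurable (restrict_space borel (sphere 0 1))"
    and h2: "h2 \<in> borel_measurable (restrict_space borel (sphere 0 1))"
    and dim: "DIM('a) \<ge> 2" and e: "norm e = 1"
    and le: "\<And>y. y \<bullet> e = 0 \<Longrightarrow> y \<noteq> 0 \<Longrightarrow>
      (\<integral>\<^sup>+s. h1 ((y + s *\<^sub>R e) /\<^sub>R norm (y + s *\<^sub>R e)) * ennreal ((norm y / norm (y + s *\<^sub>R e)) ^ DIM('a)) \<partial>lborel)
      \<le> (\<integral>\<^sup>+s. h2 ((y + s *\<^sub>R e) /\<^sub>R norm (y + s *\<^sub>R e)) * ennreal ((norm y / norm (y + s *\<^sub>R e)) ^ DIM('a)) \<partial>lborel)"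
  shows "(\<integral>\<^sup>+x. h1 x \<partial>sphere_measure) \<le> (\<integral>\<^sup>+x. h2 x \<partial>sphere_measure)"
proof -
  define q where "q = (\<lambda>x. norm (x - (x \<bullet> e) *\<^sub>R e))"
  define T where "T h x = h (x /\<^sub>R norm x) * indicator (- {0}) x * (ennreal ((q x / norm x) ^ DIM('a)) * indicator {0<..1} (q x))"
    for h :: "'a \<Rightarrow> ennreal" and x
  have ee: "e \<bullet> e = 1" using e by (simp add: norm_eq_1)
  have [measurable]: "q \<in> borel_measurable borel" unfolding q_def by measurable
  have T: "(\<integral>\<^sup>+x. h x \<partial>sphere_measure) = of_nat DIM('a) * (\<integral>\<^sup>+x. indicator {0..1} (x \<bullet> e)
      * (\<integral>\<^sup>+t. T h (x - (x \<bullet> e) *\<^sub>R e + t *\<^sub>R e) \<partial>lborel) \<partial>lborel)"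
    if "h \<in> borel_measurable (restrict_space borel (sphere 0 1))" for h
  proof -
    note [measurable] = nn_integral_sphere_measure(1)[OF that dim]
    have "T h \<in> borel_measurable borel" unfolding T_def by measurable
    then show ?thesis
      by (subst nn_integral_lborel_lines[OF _ e, symmetric])
         (simp_all add: nn_integral_sphere_measure(2)[OF that dim, of e] T_def[abs_def] q_def)
  qed
  \<comment> \<open>The gauge is constant along the line, so the cylinder contains the whole line or
    none of it.\<close>
  have line: "(\<integral>\<^sup>+t. T h (y + t *\<^sub>R e) \<partial>lborel) = (if 0 < norm y \<and> norm y \<le> 1 then
      (\<integral>\<^sup>+s. h ((y + s *\<^sub>R e) /\<^sub>R norm (y + s *\<^sub>R e)) * ennreal ((norm y / norm (y + s *\<^sub>R e)) ^ DIM('a)) \<partial>lborel)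
      else 0)" if y: "y \<bullet> e = 0" for h y
  proof -
    have q: "q (y + t *\<^sub>R e) = norm y" for t
      using y ee by (simp add: q_def inner_add_left)
    have nz: "y + t *\<^sub>R e \<noteq> 0" if "y \<noteq> 0" for t
      using q[of t] that by (auto simp: q_def)
    show ?thesis
      using nz by (auto simp: T_def q intro!: nn_integral_cong)
  qed
  have "(\<integral>\<^sup>+t. T h1 (x - (x \<bullet> e) *\<^sub>R e + t *\<^sub>R e) \<partial>lborel)
      \<le> (\<integral>\<^sup>+t. T h2 (x - (x \<bullet> e) *\<^sub>R e + t *\<^sub>R e) \<partial>lborel)" for x
    using le[of "x - (x \<bullet> e) *\<^sub>R e"] ee by (simp add: line inner_diff_left)
  then show ?thesis
    unfolding T[OF h1] T[OF h2]
    by (intro mult_left_mono[OF nn_integral_mono[OF mult_left_mono]]) (simp_all only: zero_le)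
qed

section \<open>Existence and continuity of the spherical gradient\<close>

lemma smooth_on_sphere_gradient:
  fixes u :: "'a::euclidean_space \<Rightarrow> real"
  assumes u: "smooth_on (sphere 0 1) u"
  shows "\<And>x. x \<in> sphere 0 1 \<Longrightarrow> is_sphere_gradient u x (sphere_gradient u x)"
    and "continuous_on (sphere 0 1) (sphere_gradient u)"
proof -
  have key: "is_sphere_gradient u x (sphere_gradient u x) \<and>
      continuous (at x within sphere 0 1) (sphere_gradient u)" if x: "x \<in> sphere 0 1" for x
  proof -
    obtain U F where U: "x \<in> U" "open U" "Ck_on 1 U F" and eq: "\<And>y. y \<in> U \<inter> sphere 0 1 \<Longrightarrow> F y = u y"
      using u x unfolding smooth_on_def Cinf_on_open_def by metis
    \<comment> \<open>The Euclidean gradient of the local extension; its tangential part is the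
      spherical gradient on the whole neighbourhood, so continuity carries over.\<close>
    define g where "g y = (\<Sum>b\<in>Basis. frechet_derivative F (at y) b *\<^sub>R b)" for y
    have der: "(F has_derivative (\<lambda>h. g y \<bullet> h)) (at y)" if "y \<in> U" for y
    proof -
      have d: "(F has_derivative frechet_derivative F (at y)) (at y)"
        using U(3) that by (simp add: frechet_derivative_works)
      then interpret linear "frechet_derivative F (at y)" by (rule has_derivative_linear)
      have "frechet_derivative F (at y) h = g y \<bullet> h" for h
      proof -
        have "frechet_derivative F (at y) h = frechet_derivative F (at y) (\<Sum>b\<in>Basis. (h \<bullet> b) *\<^sub>R b)"
          by (simp add: euclidean_representation)
        also have "\<dots> = g y \<bullet> h"
          by (simp only: sum scale g_def inner_sum_left)
             (simp add: inner_commute mult.commute)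
        finally show ?thesis .
      qed
      then show ?thesis using d by (metis (no_types, lifting) ext)
    qed
    have grad: "is_sphere_gradient u y (g y - (g y \<bullet> y) *\<^sub>R y)" "sphere_gradient u y = g y - (g y \<bullet> y) *\<^sub>R y"
      if "y \<in> U \<inter> sphere 0 1" for y
      using sphere_gradient_eq[OF _ U(2) _ der eq] that by auto
    have "continuous_on U (\<lambda>y. g y - (g y \<bullet> y) *\<^sub>R y)"
      using U(3) unfolding g_def by (auto intro!: continuous_intros)
    then have "continuous_on (sphere 0 1 \<inter> U) (\<lambda>y. g y - (g y \<bullet> y) *\<^sub>R y)"
      by (rule continuous_on_subset) auto
    then have "continuous_on (sphere 0 1 \<inter> U) (sphere_gradient u)"
      by (rule continuous_on_eq) (simp add: grad)
    then have "continuous (at x within sphere 0 1 \<inter> U) (sphere_gradient u)"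
      using x U by (simp add: continuous_on_eq_continuous_within)
    then have "continuous (at x within sphere 0 1) (sphere_gradient u)"
      using at_within_nhd[OF U(1,2), of "sphere 0 1 \<inter> U" "sphere 0 1"] by auto
    then show ?thesis using grad x U by simp
  qed
  then show "\<And>x. x \<in> sphere 0 1 \<Longrightarrow> is_sphere_gradient u x (sphere_gradient u x)"
    "continuous_on (sphere 0 1) (sphere_gradient u)"
    by (auto simp: continuous_on_eq_continuous_within)
qed

lemma smooth_on_sphere_continuous:
  assumes "smooth_on (sphere 0 1) u"
  shows "continuous_on (sphere 0 1) u"
  using smooth_on_sphere_gradient(1)[OF assms] unfolding is_sphere_gradient_def
  by (meson continuous_on_eq_continuous_within has_derivative_continuous)

section \<open>The inequality on the sphere\<close>

text \<open>The curve \<open>c\<close> traverses the open meridian from -e to e through y / |y|. Its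
  latitude is arctan (s / \<rho>), so its speed is \<rho> / R^2 with R =
  \<open>line_norm \<rho> s\<close>, and Cauchy-Schwarz gives the derivative bound of
  \<open>line_hardy\<close>.\<close>

lemma line_hardy_meridian:
  fixes u :: "'a::euclidean_space \<Rightarrow> real" and m :: nat and y e :: 'a
  assumes u: "smooth_on (sphere 0 1) u"
    and e: "norm e = 1" and y: "y \<bullet> e = 0" "y \<noteq> 0"
  defines "a \<equiv> (real m + 1) / (real m + 2)" and "\<rho> \<equiv> norm y"
    and "c \<equiv> \<lambda>s. (y + s *\<^sub>R e) /\<^sub>R norm (y + s *\<^sub>R e)"
  shows "(\<integral>\<^sup>+s. ennreal (a ^ (m + 2) * (\<bar>u (c s)\<bar> ^ (m + 2) * (\<bar>s\<bar> / \<rho>) ^ (m + 2) / line_log \<rho> s ^ (m + 2))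
            * (\<rho> / line_norm \<rho> s) ^ (m + 3)) \<partial>lborel)
    \<le> (\<integral>\<^sup>+s. ennreal ((norm (sphere_gradient u (c s)) ^ (m + 2)
            + (real m + 1) * a ^ (m + 1) * (\<bar>u (c s)\<bar> ^ (m + 2) * (\<bar>s\<bar> / \<rho>) ^ m / line_log \<rho> s ^ (m + 1)))
            * (\<rho> / line_norm \<rho> s) ^ (m + 3)) \<partial>lborel)"
proof -
  have rho: "\<rho> > 0" using y by (simp add: \<rho>_def)
  let ?R = "line_norm \<rho>"
  note R = line_norm_pos[OF rho]
  have ee: "e \<bullet> e = 1" using e by (simp add: norm_eq_1)
  have norm_line: "norm (y + s *\<^sub>R e) = ?R s" for s
    using y ee by (simp add: norm_eq_sqrt_inner line_norm_def \<rho>_def algebra_simps power2_eq_square inner_commute)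
  have c: "c s = (1 / ?R s) *\<^sub>R (y + s *\<^sub>R e)" for s
    by (simp add: c_def norm_line divide_inverse)
  have c_sphere: "c s \<in> sphere 0 1" for s
    using R[of s] by (simp add: c norm_line)
  \<comment> \<open>The product rule gives e / R - s (y + s e) / R^3; substituting R^2 = s^2 +
    \<rho>^2 leaves this form.\<close>
  define c' where "c' = (\<lambda>s. (1 / ?R s ^ 3) *\<^sub>R (\<rho>\<^sup>2 *\<^sub>R e - s *\<^sub>R y))"
  have c_der: "(c has_vector_derivative c' s) (at s)" for s
  proof -
    have "((\<lambda>s. 1 / ?R s) has_real_derivative - (s / ?R s ^ 3)) (at s)"
      by (rule derivative_eq_intros DERIV_line_norm[OF rho] refl
          | use R[of s] in \<open>simp add: power2_eq_square power3_eq_cube\<close>)+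
    moreover have "((\<lambda>s. y + s *\<^sub>R e) has_vector_derivative e) (at s)"
      by (auto intro!: derivative_eq_intros)
    ultimately have "((\<lambda>s. (1 / ?R s) *\<^sub>R (y + s *\<^sub>R e)) has_vector_derivative
        (1 / ?R s) *\<^sub>R e + (- (s / ?R s ^ 3)) *\<^sub>R (y + s *\<^sub>R e)) (at s)"
      by (rule has_vector_derivative_scaleR)
    moreover have "(1 / ?R s) *\<^sub>R e + (- (s / ?R s ^ 3)) *\<^sub>R (y + s *\<^sub>R e) = c' s"
    proof -
      have "1 / ?R s = (s\<^sup>2 + \<rho>\<^sup>2) / ?R s ^ 3"
        using R[of s] unfolding line_norm_sq[OF rho, symmetric]
        by (simp add: power2_eq_square power3_eq_cube)
      then show ?thesis
        by (simp add: c'_def algebra_simps add_divide_distrib power2_eq_square)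
    qed
    moreover have "c = (\<lambda>s. (1 / ?R s) *\<^sub>R (y + s *\<^sub>R e))" using c by auto
    ultimately show ?thesis by simp
  qed
  have norm_c': "norm (c' s) = \<rho> / (?R s)\<^sup>2" for s
  proof -
    have "(norm (\<rho>\<^sup>2 *\<^sub>R e - s *\<^sub>R y))\<^sup>2 = (\<rho> * ?R s)\<^sup>2"
      using y ee line_norm_sq[OF rho, of s]
      by (simp add: power2_norm_eq_inner power_mult_distrib inner_diff_left inner_diff_right inner_commute \<rho>_def)
         (simp add: power2_norm_eq_inner[symmetric] algebra_simps power2_eq_square)
    then have "norm (\<rho>\<^sup>2 *\<^sub>R e - s *\<^sub>R y) = \<rho> * ?R s"
      using rho R[of s] by (simp add: power2_eq_iff_nonneg)
    then show ?thesis using R[of s] by (simp add: c'_def power2_eq_square power3_eq_cube)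
  qed
  \<comment> \<open>Differentiability of \<open>u\<close> is available only within the sphere, so
    the chain rule is applied within the range of \<open>c\<close>.\<close>
  have u_der: "((\<lambda>s. u (c s)) has_real_derivative sphere_gradient u (c s) \<bullet> c' s) (at s)" for s
  proof -
    have "(u has_derivative (\<lambda>h. sphere_gradient u (c s) \<bullet> h)) (at (c s) within range c)"
      using smooth_on_sphere_gradient(1)[OF u c_sphere[of s]] c_sphere
      unfolding is_sphere_gradient_def by (auto intro: has_derivative_subset)
    from diff_chain_within[OF c_der[of s, unfolded has_vector_derivative_def] this]
    show ?thesis by (simp add: o_def has_field_derivative_def mult.commute[of _ "_ \<bullet> _"])
  qed
  have cont_c: "continuous_on UNIV c"
    using c_der by (meson continuous_at_imp_continuous_on has_vector_derivative_continuous)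
  have cont_grad: "continuous_on UNIV (\<lambda>s. sphere_gradient u (c s))"
    by (rule continuous_on_compose2[OF smooth_on_sphere_gradient(2)[OF u] cont_c]) (use c_sphere in auto)
  have "continuous_on (sphere 0 1) u" by (rule smooth_on_sphere_continuous[OF u])
  then have "bounded (u ` sphere 0 1)"
    by (intro compact_imp_bounded compact_continuous_image) auto
  then obtain K where K: "\<forall>v\<in>u ` sphere 0 1. norm v \<le> K"
    unfolding bounded_iff by blast
  show ?thesis
    unfolding a_def
  proof (rule line_hardy[OF rho u_der])
    show "continuous_on UNIV (\<lambda>s. sphere_gradient u (c s) \<bullet> c' s)"
      unfolding c'_def using R
      by (intro continuous_intros cont_grad continuous_on_line_norm[OF rho]) (auto simp: less_imp_neq[THEN not_sym])
    show "\<bar>sphere_gradient u (c s) \<bullet> c' s\<bar> \<le> norm (sphere_gradient u (c s)) * \<rho> / (?R s)\<^sup>2" for s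
      using Cauchy_Schwarz_ineq2[of "sphere_gradient u (c s)" "c' s"] by (simp add: norm_c')
    show "\<bar>u (c s)\<bar> \<le> K" for s using bspec[OF K imageI[OF c_sphere[of s]]] by simp
  qed (auto intro: continuous_intros cont_grad)
qed

text \<open>Here \<open>x \<bullet> e\<close> is cos d and \<open>S x\<close> is sin d. As the
  ambient dimension is m + 3, the cylinder weight is precisely the power in
  \<open>line_hardy_meridian\<close>. The constants stay inside the integrals so that a single
  comparison along meridians suffices.\<close>

lemma sphere_hardy:
  fixes u :: "'a::euclidean_space \<Rightarrow> real" and m :: nat and e :: 'a
  assumes u: "smooth_on (sphere 0 1) u" and e: "norm e = 1" and dim: "DIM('a) = m + 3"
  defines "a \<equiv> (real m + 1) / (real m + 2)"
    and "S \<equiv> \<lambda>x. sqrt (1 - (x \<bullet> e)\<^sup>2)"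
  shows "(\<integral>\<^sup>+x. ennreal (a ^ (m + 2) * (\<bar>u x\<bar> ^ (m + 2) * (\<bar>x \<bullet> e\<bar> / S x) ^ (m + 2) / ln (exp 1 / S x) ^ (m + 2))) \<partial>sphere_measure)
    \<le> (\<integral>\<^sup>+x. ennreal (norm (sphere_gradient u x) ^ (m + 2)
        + (real m + 1) * a ^ (m + 1) * (\<bar>u x\<bar> ^ (m + 2) * (\<bar>x \<bullet> e\<bar> / S x) ^ m / ln (exp 1 / S x) ^ (m + 1))) \<partial>sphere_measure)"
proof -
  have ee: "e \<bullet> e = 1" using e by (simp add: norm_eq_1)
  have cu: "continuous_on (sphere 0 1) u" by (rule smooth_on_sphere_continuous[OF u])
  have [measurable]: "u \<in> borel_measurable (restrict_space borel (sphere 0 1))"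
    "sphere_gradient u \<in> borel_measurable (restrict_space borel (sphere 0 1))"
    by (intro borel_measurable_continuous_on_restrict cu smooth_on_sphere_gradient(2)[OF u])+
  have [measurable]: "(\<lambda>x. x \<bullet> e) \<in> borel_measurable (restrict_space borel (sphere 0 1))"
    by (intro borel_measurable_continuous_on_restrict continuous_intros)
  define h1 where "h1 x = ennreal (a ^ (m + 2) * (\<bar>u x\<bar> ^ (m + 2) * (\<bar>x \<bullet> e\<bar> / S x) ^ (m + 2)
    / ln (exp 1 / S x) ^ (m + 2)))" for x
  define h2 where "h2 x = ennreal (norm (sphere_gradient u x) ^ (m + 2)
    + (real m + 1) * a ^ (m + 1) * (\<bar>u x\<bar> ^ (m + 2) * (\<bar>x \<bullet> e\<bar> / S x) ^ m / ln (exp 1 / S x) ^ (m + 1)))" for x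
  have "(\<integral>\<^sup>+x. h1 x \<partial>sphere_measure) \<le> (\<integral>\<^sup>+x. h2 x \<partial>sphere_measure)"
  proof (rule nn_integral_sphere_mono_meridians[OF _ _ _ e])
    fix y :: 'a
    assume y: "y \<bullet> e = 0" "y \<noteq> 0"
    define \<rho> where "\<rho> = norm y"
    define c where "c s = (y + s *\<^sub>R e) /\<^sub>R norm (y + s *\<^sub>R e)" for s
    have rho: "\<rho> > 0" using y by (simp add: \<rho>_def)
    note R = line_norm_pos[OF rho]
    have norm_line: "norm (y + s *\<^sub>R e) = line_norm \<rho> s" for s
      using y ee by (simp add: norm_eq_sqrt_inner line_norm_def \<rho>_def algebra_simps power2_eq_square inner_commute)
    have ce: "c s \<bullet> e = s / line_norm \<rho> s" for s
      using y ee unfolding c_def norm_line by (simp add: inner_add_left divide_inverse mult.commute)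
    have S: "S (c s) = \<rho> / line_norm \<rho> s" for s
    proof -
      have "1 - (s / line_norm \<rho> s)\<^sup>2 = (\<rho> / line_norm \<rho> s)\<^sup>2"
      proof -
        have "1 - (s / line_norm \<rho> s)\<^sup>2 = ((line_norm \<rho> s)\<^sup>2 - s\<^sup>2) / (line_norm \<rho> s)\<^sup>2"
          using R[of s] by (simp add: power_divide diff_divide_distrib)
        then show ?thesis by (simp add: line_norm_sq[OF rho] power_divide)
      qed
      then show ?thesis using rho R[of s] by (simp add: S_def ce)
    qed
    have C: "\<bar>c s \<bullet> e\<bar> / S (c s) = \<bar>s\<bar> / \<rho>" for s
      using R[of s] rho by (simp add: S ce field_simps)
    have L: "ln (exp 1 / S (c s)) = line_log \<rho> s" for s
      using R[of s] rho by (simp add: S line_log_def ln_div ln_mult)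
    have M: "0 \<le> (\<rho> / line_norm \<rho> s) ^ (m + 3)" for s
      using rho R[of s] by simp
    show "(\<integral>\<^sup>+s. h1 ((y + s *\<^sub>R e) /\<^sub>R norm (y + s *\<^sub>R e)) * ennreal ((norm y / norm (y + s *\<^sub>R e)) ^ DIM('a)) \<partial>lborel)
      \<le> (\<integral>\<^sup>+s. h2 ((y + s *\<^sub>R e) /\<^sub>R norm (y + s *\<^sub>R e)) * ennreal ((norm y / norm (y + s *\<^sub>R e)) ^ DIM('a)) \<partial>lborel)"
      unfolding c_def[symmetric]
      unfolding h1_def h2_def C L dim norm_line \<rho>_def[symmetric] a_def ennreal_mult''[OF M, symmetric]
      by (rule line_hardy_meridian[OF u e y, of m, folded c_def, folded \<rho>_def])
  qed (use dim in \<open>simp_all add: h1_def h2_def S_def\<close>)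
  then show ?thesis by (simp only: h1_def h2_def)
qed

theorem theorem2:
  fixes n :: nat
    and u d :: "real ^ 'N \<Rightarrow> real"
    and \<Phi> :: "real ^ 'N"
  assumes "n \<ge> 2" and "CARD('N) = n + 1"
    and "smooth_on (sphere 0 1) u"
    and "\<Phi> \<in> sphere 0 1"
    and "d = (\<lambda>x. arccos (\<Sum>m\<in>UNIV. x $ m * \<Phi> $ m))"
  shows "(\<integral>\<^sup>+x. ennreal (norm (sphere_gradient u x) ^ n) \<partial>sphere_measure)
      + ennreal ((real n - 1) * ((real n - 1) / real n) ^ (n - 1))
        * (\<integral>\<^sup>+x. ennreal (\<bar>u x\<bar> ^ n * (\<bar>cos (d x)\<bar> / sin (d x)) ^ (n - 2)
              / ln (exp 1 / sin (d x)) ^ (n - 1)) \<partial>sphere_measure)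
    \<ge> ennreal (((real n - 1) / real n) ^ n)
        * (\<integral>\<^sup>+x. ennreal (\<bar>u x\<bar> ^ n * (\<bar>cos (d x)\<bar> / sin (d x)) ^ n
              / ln (exp 1 / sin (d x)) ^ n) \<partial>sphere_measure)"
proof -
  \<comment> \<open>Turns the truncated differences n - 2 and n - 1 into m and m + 1.\<close>
  obtain m where m: "n = m + 2" using assms(1) by (metis le_add_diff_inverse2)
  have e: "norm \<Phi> = 1" using assms(4) by simp
  define a where "a = (real m + 1) / (real m + 2)"
  define S where "S x = sqrt (1 - (x \<bullet> \<Phi>)\<^sup>2)" for x :: "real ^ 'N"
  define X where "X x = \<bar>u x\<bar> ^ (m + 2) * (\<bar>x \<bullet> \<Phi>\<bar> / S x) ^ (m + 2) / ln (exp 1 / S x) ^ (m + 2)" for x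
  define Y where "Y x = \<bar>u x\<bar> ^ (m + 2) * (\<bar>x \<bullet> \<Phi>\<bar> / S x) ^ m / ln (exp 1 / S x) ^ (m + 1)" for x
  have a: "a \<ge> 0" "(real n - 1) / real n = a" by (simp_all add: a_def m add.commute)
  have abs_le: "\<bar>x \<bullet> \<Phi>\<bar> \<le> 1" if "x \<in> sphere 0 1" for x
    using Cauchy_Schwarz_ineq2[of x \<Phi>] e that by simp
  have d: "cos (d x) = x \<bullet> \<Phi>" "sin (d x) = S x" if "x \<in> sphere 0 1" for x
  proof -
    have "d x = arccos (x \<bullet> \<Phi>)" by (simp add: assms(5) inner_vec_def)
    then show "cos (d x) = x \<bullet> \<Phi>" "sin (d x) = S x"
      using abs_le[OF that] by (simp_all add: S_def cos_arccos_abs sin_arccos_abs)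
  qed
  have S: "0 \<le> S x" "S x \<le> 1" if "x \<in> sphere 0 1" for x
    using abs_le[OF that] by (simp_all add: S_def abs_square_le_1)
  \<comment> \<open>At the two poles \<open>S x = 0\<close>, and the conventions
    \<open>exp 1 / 0 = 0\<close> and \<open>ln 0 = 0\<close> give the value 0.\<close>
  have ln_nonneg: "0 \<le> ln (exp 1 / S x)" if x: "x \<in> sphere 0 1" for x
  proof (cases "S x = 0")
    case False
    then have "S x > 0" using S[OF x] by simp
    moreover have "S x \<le> exp 1" using S[OF x] one_le_exp_iff[of 1] by linarith
    ultimately show ?thesis by (intro ln_ge_zero) simp
  qed simp
  have Y: "0 \<le> Y x" if "x \<in> sphere 0 1" for x
    using S[OF that] ln_nonneg[OF that] by (simp add: Y_def)
  have [measurable]: "u \<in> borel_measurable (restrict_space borel (sphere 0 1))"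
    "sphere_gradient u \<in> borel_measurable (restrict_space borel (sphere 0 1))"
    "(\<lambda>x. x \<bullet> \<Phi>) \<in> borel_measurable (restrict_space borel (sphere 0 1))"
    using smooth_on_sphere_continuous[OF assms(3)] smooth_on_sphere_gradient(2)[OF assms(3)]
    by (auto intro!: borel_measurable_continuous_on_restrict continuous_intros)
  have [measurable]: "X \<in> borel_measurable sphere_measure" "Y \<in> borel_measurable sphere_measure"
    "sphere_gradient u \<in> borel_measurable sphere_measure"
    unfolding measurable_cong_sets[OF sets_sphere_measure refl] X_def Y_def S_def by measurable
  have "ennreal (a ^ (m + 2)) * (\<integral>\<^sup>+x. ennreal (X x) \<partial>sphere_measure)
      = (\<integral>\<^sup>+x. ennreal (a ^ (m + 2) * X x) \<partial>sphere_measure)"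
    using a by (simp add: nn_integral_cmult ennreal_mult' del: power_Suc)
  also have "\<dots> \<le> (\<integral>\<^sup>+x. ennreal (norm (sphere_gradient u x) ^ (m + 2) + (real m + 1) * a ^ (m + 1) * Y x) \<partial>sphere_measure)"
    using sphere_hardy[OF assms(3) e, of m] assms(2) by (simp add: X_def Y_def a_def S_def m)
  \<comment> \<open>\<open>ennreal\<close> truncates negative reals, so splitting the sum relies on
    the nonnegativity of \<open>Y\<close> on the sphere.\<close>
  also have "\<dots> = (\<integral>\<^sup>+x. ennreal (norm (sphere_gradient u x) ^ (m + 2))
      + ennreal ((real m + 1) * a ^ (m + 1)) * ennreal (Y x) \<partial>sphere_measure)"
    using a Y by (intro nn_integral_cong) (simp add: ennreal_plus ennreal_mult' del: power_Suc)
  also have "\<dots> = (\<integral>\<^sup>+x. ennreal (norm (sphere_gradient u x) ^ (m + 2)) \<partial>sphere_measure)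
      + ennreal ((real m + 1) * a ^ (m + 1)) * (\<integral>\<^sup>+x. ennreal (Y x) \<partial>sphere_measure)"
    by (simp add: nn_integral_add nn_integral_cmult)
  also have "(\<integral>\<^sup>+x. ennreal (X x) \<partial>sphere_measure)
      = (\<integral>\<^sup>+x. ennreal (\<bar>u x\<bar> ^ n * (\<bar>cos (d x)\<bar> / sin (d x)) ^ n / ln (exp 1 / sin (d x)) ^ n) \<partial>sphere_measure)"
    by (intro nn_integral_cong) (simp add: X_def d m)
  also have "(\<integral>\<^sup>+x. ennreal (Y x) \<partial>sphere_measure)
      = (\<integral>\<^sup>+x. ennreal (\<bar>u x\<bar> ^ n * (\<bar>cos (d x)\<bar> / sin (d x)) ^ (n - 2) / ln (exp 1 / sin (d x)) ^ (n - 1)) \<partial>sphere_measure)"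
    by (intro nn_integral_cong) (simp add: Y_def d m)
  moreover have "m + 2 = n" "m + 1 = n - 1" "real m + 1 = real n - 1" by (simp_all add: m)
  ultimately show ?thesis by (simp only: a(2))
qed

end
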